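(* Let $0<C<B<1$ and consider the adaptive dynamics $\dot p_i=\left.\frac{\partial A(\mathbf p,\mathbf q)}{\partial p_i}\right|_{\mathbf q=\mathbf p}$, $i=1,\ldots,4$, of the alternating memory-1 game with payoff vector $(f_1,f_2,f_3,f_4)=(B-C,-C,B,0)$. The dynamics take place on two-dimensional tori: for all $C_1,C_2>0$ the set $$\{\mathbf p\in\mathbb R^4:\ (p_1-1)^2+p_3^2=C_1,\ (p_2-1)^2+p_4^2=C_2\}$$ is a two-dimensional torus $\mathbb T^2=S^1\times S^1$, and every solution of the system starting on it remains on it for as long as it is defined.
   Context: Write $\mathbf p=(p_1,p_2,p_3,p_4)=(p_{CC},p_{CD},p_{DC},p_{DD})$ and similarly $\mathbf q$. The transition matrix of the alternating memory-1 game is $$\mathbf M_1(\mathbf p,\mathbf q)=\begin{pmatrix} p_1q_1&p_1(1-q_1)&(1-p_1)q_2&(1-p_1)(1-q_2)\\ p_2q_3&p_2(1-q_3)&(1-p_2)q_4&(1-p_2)(1-q_4)\\ p_3q_1&p_3(1-q_1)&(1-p_3)q_2&(1-p_3)(1-q_2)\\ p_4q_3&p_4(1-q_3)&(1-p_4)q_4&(1-p_4)(1-q_4)\end{pmatrix}.$$ The payoff function is $A(\mathbf p,\mathbf q)=\det\mathbf M^1/\det\mathbf M^2$, where $\mathbf M^1$ is $\mathbf M_1(\mathbf p,\mathbf q)-I$ with its last column replaced by $(f_1,f_2,f_3,f_4)^T$ and $\mathbf M^2$ is $\mathbf M_1(\mathbf p,\mathbf q)-I$ with its last column replaced by $(1,1,1,1)^T$.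 The system is considered on the set of $\mathbf p\in\mathbb R^4$ where $\det\mathbf M^2\neq0$ at $\mathbf q=\mathbf p$; this set contains $(0,1)^4$. *)

theory Defs
  imports "HOL-Analysis.Analysis"
begin

text \<open>
  The states CC, CD, DC, DD are the indices 1, 2, 3, 4 of the type \<open>4\<close>; there \<open>4 = 0\<close>, but the
  library function \<^const>\<open>vector\<close> fills the components in the order 1, 2, 3, 4.
\<close>

lemma vector_4_nth [simp]:
  "(vector [a, b, c, d] :: 'a::zero ^ 4) $ 1 = a"
  "(vector [a, b, c, d] :: 'a::zero ^ 4) $ 2 = b"
  "(vector [a, b, c, d] :: 'a::zero ^ 4) $ 3 = c"
  "(vector [a, b, c, d] :: 'a::zero ^ 4) $ 4 = d"
  by (simp_all add: vector_def)

definition alt_transition :: "real ^ 4 \<Rightarrow> real ^ 4 \<Rightarrow> real ^ 4 ^ 4" where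
  "alt_transition p q = vector [
     vector [p$1 * q$1, p$1 * (1 - q$1), (1 - p$1) * q$2, (1 - p$1) * (1 - q$2)],
     vector [p$2 * q$3, p$2 * (1 - q$3), (1 - p$2) * q$4, (1 - p$2) * (1 - q$4)],
     vector [p$3 * q$1, p$3 * (1 - q$1), (1 - p$3) * q$2, (1 - p$3) * (1 - q$2)],
     vector [p$4 * q$3, p$4 * (1 - q$3), (1 - p$4) * q$4, (1 - p$4) * (1 - q$4)]]"

definition replace_last_column :: "real ^ 4 ^ 4 \<Rightarrow> real ^ 4 \<Rightarrow> real ^ 4 ^ 4" where
  "replace_last_column M v = (\<chi> i j. if j = 4 then v $ i else M $ i $ j)"

definition bordered_det :: "real ^ 4 \<Rightarrow> real ^ 4 \<Rightarrow> real ^ 4 \<Rightarrow> real" where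
  "bordered_det v p q = det (replace_last_column (alt_transition p q - mat 1) v)"

definition payoff :: "real ^ 4 \<Rightarrow> real ^ 4 \<Rightarrow> real ^ 4 \<Rightarrow> real" where
  "payoff f p q = bordered_det f p q / bordered_det (vector [1, 1, 1, 1]) p q"

definition payoff_domain :: "(real ^ 4) set" where
  "payoff_domain = {p. bordered_det (vector [1, 1, 1, 1]) p p \<noteq> 0}"

text \<open>
  The partial derivative is taken in the first strategy with the second one held fixed, and the two
  are identified only afterwards. For \<open>p\<close> in \<^const>\<open>payoff_domain\<close> the derivative exists, since the
  payoff is a quotient of polynomials whose denominator does not vanish there; outside this set the
  value is irrelevant.
\<close>

definition adaptive_field :: "real ^ 4 \<Rightarrow> real ^ 4 \<Rightarrow> real ^ 4" where
  "adaptive_field f p =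
     (\<chi> i. deriv (\<lambda>s. payoff f (\<chi> j. if j = i then s else p $ j) p) (p $ i))"

text \<open>
  At an endpoint belonging to \<open>I\<close> the derivative is one-sided.
\<close>

definition adaptive_solution :: "real ^ 4 \<Rightarrow> real set \<Rightarrow> (real \<Rightarrow> real ^ 4) \<Rightarrow> bool" where
  "adaptive_solution f I x \<longleftrightarrow>
     is_interval I \<and>
     (\<forall>t\<in>I. x t \<in> payoff_domain \<and>
            (x has_vector_derivative adaptive_field f (x t)) (at t within I))"

definition invariant_torus :: "real \<Rightarrow> real \<Rightarrow> (real ^ 4) set" where
  "invariant_torus C1 C2 =
     {p. (p$1 - 1)\<^sup>2 + (p$3)\<^sup>2 = C1 \<and> (p$2 - 1)\<^sup>2 + (p$4)\<^sup>2 = C2}"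

end

theory Submission
  imports Defs
begin

text \<open>
  Where its denominator does not vanish, the payoff is \<open>w \<bullet> f / w \<bullet> 1\<close> for any left null vector
  \<open>w \<noteq> 0\<close> of \<open>M(p, q) - I\<close>. At \<open>q = p\<close> such a vector is
  \<open>w = (p\<^sub>3 p\<^sub>4, (1 - p\<^sub>1) p\<^sub>4, (1 - p\<^sub>1) p\<^sub>4, (1 - p\<^sub>1) (1 - p\<^sub>2))\<close>. Since \<open>w\<^sub>1 (p\<^sub>1 - 1) + w\<^sub>3 p\<^sub>3 = 0\<close> and
  \<open>w\<^sub>2 (p\<^sub>2 - 1) + w\<^sub>4 p\<^sub>4 = 0\<close>, and rows 1 and 3 (rows 2 and 4) of \<open>M\<close> depend in the same affine way on
  \<open>p\<^sub>1\<close> and \<open>p\<^sub>3\<close> (on \<open>p\<^sub>2\<close> and \<open>p\<^sub>4\<close>), the vector \<open>w\<close> stays a left null vector when the first strategy alone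
  is shifted along \<open>(p\<^sub>1 - 1, 0, p\<^sub>3, 0)\<close> or \<open>(0, p\<^sub>2 - 1, 0, p\<^sub>4)\<close>. So the payoff is constant along these
  shifts, and the adaptive field is orthogonal to the gradients of \<open>(p\<^sub>1 - 1)\<^sup>2 + p\<^sub>3\<^sup>2\<close> and
  \<open>(p\<^sub>2 - 1)\<^sup>2 + p\<^sub>4\<^sup>2\<close>.
\<close>

section \<open>Left null vectors and determinants with a replaced column\<close>

lemma det_replace_last_column_linear:
  "det (replace_last_column M (a *\<^sub>R v + b *\<^sub>R w))
    = a * det (replace_last_column M v) + b * det (replace_last_column M w)"
proof -
  \<comment> \<open>Multilinearity is used in its form for rows, so transposition first turns the
    last column into a row.\<close>
  have "det (replace_last_column M v) = det (\<chi> i. if i = 4 then v else column i M)" for v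
    by (subst det_transpose[symmetric])
      (auto simp: replace_last_column_def transpose_def column_def vec_eq_iff
        intro: arg_cong[where f = det])
  then show ?thesis
    by (simp add: det_row_add det_row_mul flip: scalar_mult_eq_scaleR)
qed

lemma det_eq_0_if_left_null:
  fixes A :: "real ^ 'n ^ 'n"
  assumes "x v* A = 0" and "x \<noteq> 0"
  shows "det A = 0"
proof (rule ccontr)
  assume "det A \<noteq> 0"
  then obtain B where B: "A ** B = mat 1"
    by (auto simp: invertible_det_nz[symmetric] invertible_def)
  have "x = (x v* A) v* B"
    by (simp add: vector_matrix_mul_assoc B)
  with assms show False
    by simp
qed

lemma det_replace_last_column_left_null:
  assumes x: "x v* M = 0" and "x \<noteq> 0" and v: "x \<bullet> v = 0"
  shows "det (replace_last_column M v) = 0"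
proof (rule det_eq_0_if_left_null)
  have "(x v* replace_last_column M v) $ j = (if j = 4 then x \<bullet> v else (x v* M) $ j)" for j
    by (simp add: vector_matrix_mult_def replace_last_column_def inner_vec_def mult.commute)
  then show "x v* replace_last_column M v = 0"
    by (simp add: vec_eq_iff x v)
qed fact

text \<open>The combination \<open>(x \<bullet> w) v - (x \<bullet> v) w\<close> is orthogonal to
  \<open>x\<close>, so its determinant vanishes; linearity then splits it into the two
  terms.\<close>

lemma det_replace_last_column_proportional:
  assumes "x v* M = 0"
  shows "(x \<bullet> w) * det (replace_last_column M v) = (x \<bullet> v) * det (replace_last_column M w)"
proof (cases "x = 0")
  case False
  have "det (replace_last_column M ((x \<bullet> w) *\<^sub>R v + (- (x \<bullet> v)) *\<^sub>R w)) = 0"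
    using assms False
    by (rule det_replace_last_column_left_null) (simp add: inner_diff_right)
  then show ?thesis
    unfolding det_replace_last_column_linear by simp
qed simp

section \<open>Stationary weights and the payoff along shifts\<close>

definition fixed_weights :: "real ^ 4 \<Rightarrow> real ^ 4" where
  "fixed_weights p =
     vector [p$3 * p$4, (1 - p$1) * p$4, (1 - p$1) * p$4, (1 - p$1) * (1 - p$2)]"

text \<open>Radial in the two circles of the torus, hence normal to it; \<open>s\<close> and
  \<open>t\<close> scale the two radial directions separately.\<close>

definition tangent_shift :: "real ^ 4 \<Rightarrow> real \<Rightarrow> real \<Rightarrow> real ^ 4" where
  "tangent_shift p s t = vector [s * (p$1 - 1), t * (p$2 - 1), s * p$3, t * p$4]"

lemmas left_null_simps =
  vec_eq_iff forall_4 vector_matrix_mult_def sum_4 alt_transition_def mat_def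

lemma fixed_weights_left_null:
  "fixed_weights p v* (alt_transition (p + tangent_shift p s t) p - mat 1) = 0"
  by (simp add: left_null_simps fixed_weights_def tangent_shift_def; intro conjI; algebra)

lemma tangent_shift_0 [simp]: "tangent_shift p 0 0 = 0"
  by (simp add: tangent_shift_def vec_eq_iff forall_4)

text \<open>On the domain a left null vector whose entries sum to 0 must vanish, so it suffices that
  the weights are not all zero.\<close>

lemma fixed_weights_inner_nonzero:
  assumes "p \<in> payoff_domain"
  shows "fixed_weights p \<bullet> vector [1, 1, 1, 1] \<noteq> 0"
proof -
  let ?N = "alt_transition p p - mat 1" and ?e = "vector [1, 1, 1, 1] :: real ^ 4"
  have null: "x = 0" if "x v* ?N = 0" "x \<bullet> ?e = 0" for x
    using det_replace_last_column_left_null[OF that(1) _ that(2)] assms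
    by (auto simp: payoff_domain_def bordered_det_def)
  have "fixed_weights p \<noteq> 0"
  proof
    assume "fixed_weights p = 0"
    then have w: "p$3 = 0 \<or> p$4 = 0" "p$1 = 1 \<or> p$4 = 0" "p$1 = 1 \<or> p$2 = 1"
      by (auto simp: fixed_weights_def vec_eq_iff forall_4)
    consider "p$1 = 1" "p$4 = 0" | "p$1 = 1" "p$3 = 0" "p$4 \<noteq> 0" | "p$4 = 0" "p$2 = 1" "p$1 \<noteq> 1"
      using w by (cases "p$4 = 0"; cases "p$1 = 1") auto
    \<comment> \<open>In each case the chain has two closed classes; two stationary vectors, scaled to equal sums,
      differ by a nonzero null vector with sum 0.\<close>
    then show False
    proof cases
      case 1
      have "vector [1, 0, 0, - 1] = (0 :: real ^ 4)"
        by (rule null) (use 1 in \<open>simp_all add: left_null_simps inner_vec_def\<close>)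
      then show False
        by (simp add: vec_eq_iff forall_4)
    next
      case 2
      have "vector [2 * p$4 + (1 - p$2), - p$4, - p$4, p$2 - 1] = (0 :: real ^ 4)"
        by (rule null)
          (use 2 in \<open>simp_all add: left_null_simps inner_vec_def, simp_all add: algebra_simps\<close>)
      then show False
        using 2 by (simp add: vec_eq_iff forall_4)
    next
      case 3
      have "vector [p$3, 1 - p$1, 1 - p$1, - (p$3 + 2 * (1 - p$1))] = (0 :: real ^ 4)"
        by (rule null)
          (use 3 in \<open>simp_all add: left_null_simps inner_vec_def, simp_all add: algebra_simps\<close>)
      then show False
        using 3 by (simp add: vec_eq_iff forall_4)
    qed
  qed
  then show ?thesis
    using null fixed_weights_left_null[of p 0 0] by auto
qed

text \<open>The right-hand side is free of \<open>s\<close> and \<open>t\<close>, which is the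
  constancy along the shift. It results from dividing the proportionality of the two determinants by
  both nonzero denominators.\<close>

lemma payoff_tangent_shift:
  assumes "p \<in> payoff_domain"
    and "bordered_det (vector [1, 1, 1, 1]) (p + tangent_shift p s t) p \<noteq> 0"
  shows "payoff f (p + tangent_shift p s t) p
    = (fixed_weights p \<bullet> f) / (fixed_weights p \<bullet> vector [1, 1, 1, 1])"
  using det_replace_last_column_proportional[OF fixed_weights_left_null, of p "vector [1, 1, 1, 1]" s t f]
    fixed_weights_inner_nonzero[OF assms(1)] assms(2)
  by (simp add: payoff_def bordered_det_def field_simps)

lemma payoff_diagonal:
  assumes "p \<in> payoff_domain"
  shows "payoff f p p = (fixed_weights p \<bullet> f) / (fixed_weights p \<bullet> vector [1, 1, 1, 1])"
  using payoff_tangent_shift[OF assms, of 0 0 f] assms by (simp add: payoff_domain_def)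

section \<open>Differentiability and the field as a gradient\<close>

lemma differentiable_bordered_det: "(\<lambda>p. bordered_det v p q) differentiable (at p)"
proof -
  have nth: "(\<lambda>p :: real ^ 4. p $ k) differentiable (at p)" for k
    by (rule bounded_linear_imp_differentiable[OF bounded_linear_vec_nth])
  have "(\<lambda>p. replace_last_column (alt_transition p q - mat 1) v $ i $ j) differentiable (at p)"
    for i j
    using exhaust_4[of i] exhaust_4[of j]
    by (elim disjE; simp add: replace_last_column_def alt_transition_def nth)
  then obtain E where E: "((\<lambda>p. replace_last_column (alt_transition p q - mat 1) v $ i $ j)
      has_derivative E i j) (at p)" for i j
    unfolding differentiable_def by metis
  have "(\<lambda>p. \<Prod>i\<in>UNIV. replace_last_column (alt_transition p q - mat 1) v $ i $ \<pi> i)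
      differentiable (at p)" for \<pi>
    unfolding differentiable_def by (rule exI, rule has_derivative_prod, rule E)
  then show ?thesis
    unfolding bordered_det_def det_def by simp
qed

lemma differentiable_payoff:
  assumes "p \<in> payoff_domain"
  shows "(\<lambda>p'. payoff f p' p) differentiable (at p)"
  using assms unfolding payoff_def payoff_domain_def
  by (intro differentiable_divide differentiable_bordered_det) auto

lemma adaptive_field_nth:
  assumes "((\<lambda>p'. payoff f p' p) has_derivative F) (at p)"
  shows "adaptive_field f p $ i = F (axis i 1)"
proof -
  \<comment> \<open>Overwriting coordinate \<open>i\<close> is motion along an axis, so the chain
    rule expresses the partial derivative through \<open>F\<close>.\<close>
  have upd: "(\<chi> j. if j = i then s else p $ j) = p + (s - p $ i) *\<^sub>R axis i 1" for s
    by (simp add: vec_eq_iff axis_def)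
  have "((\<lambda>s. p + (s - p $ i) *\<^sub>R axis i 1) has_derivative (\<lambda>h. h *\<^sub>R axis i 1)) (at (p $ i))"
    by (auto intro!: derivative_eq_intros)
  from has_derivative_compose[OF this, of "\<lambda>p'. payoff f p' p" F]
  have "((\<lambda>s. payoff f (p + (s - p $ i) *\<^sub>R axis i 1) p) has_derivative
      (\<lambda>h. F (h *\<^sub>R axis i 1))) (at (p $ i))"
    using assms by simp
  then have "((\<lambda>s. payoff f (p + (s - p $ i) *\<^sub>R axis i 1) p) has_real_derivative F (axis i 1))
      (at (p $ i))"
    using has_derivative_bounded_linear[OF assms]
    by (simp add: has_field_derivative_def linear_simps mult_commute_abs)
  then show ?thesis
    by (simp add: adaptive_field_def upd DERIV_imp_deriv)
qed

text \<open>By continuity the denominator stays nonzero near \<open>r = 0\<close>, where the formula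
  for the shifted payoff then applies.\<close>

lemma eventually_bordered_det_nonzero:
  assumes "p \<in> payoff_domain"
  shows "\<forall>\<^sub>F r in at 0. bordered_det (vector [1, 1, 1, 1]) (p + r *\<^sub>R d) p \<noteq> 0"
proof -
  have "isCont (\<lambda>r. p + r *\<^sub>R d) 0"
    by (intro continuous_intros)
  moreover have "isCont (\<lambda>p'. bordered_det (vector [1, 1, 1, 1]) p' p) (p + 0 *\<^sub>R d)"
    by (rule differentiable_imp_continuous_within[OF differentiable_bordered_det])
  ultimately have "isCont (\<lambda>r. bordered_det (vector [1, 1, 1, 1]) (p + r *\<^sub>R d) p) 0"
    by (rule isCont_o2)
  then show ?thesis
    using assms by (intro tendsto_imp_eventually_ne) (auto simp: isCont_def payoff_domain_def)
qed

lemma scaleR_tangent_shift: "r *\<^sub>R tangent_shift p s t = tangent_shift p (r * s) (r * t)"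
  by (simp add: tangent_shift_def vec_eq_iff forall_4)

lemma eventually_payoff_tangent_shift:
  assumes "p \<in> payoff_domain"
  shows "\<forall>\<^sub>F r in at 0. payoff f (p + r *\<^sub>R tangent_shift p s t) p = payoff f p p"
  using eventually_bordered_det_nonzero[OF assms, of "tangent_shift p s t"]
  by eventually_elim (simp add: scaleR_tangent_shift payoff_tangent_shift payoff_diagonal assms)

text \<open>The field is the gradient of the payoff in its first argument, so the inner product is a
  directional derivative of a locally constant function.\<close>

lemma adaptive_field_tangent_shift:
  assumes "p \<in> payoff_domain"
  shows "adaptive_field f p \<bullet> tangent_shift p s t = 0"
proof -
  let ?d = "tangent_shift p s t"
  obtain F where F: "((\<lambda>p'. payoff f p' p) has_derivative F) (at p)"
    using differentiable_payoff[OF assms] by (auto simp: differentiable_def)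
  have "((\<lambda>r. p + r *\<^sub>R ?d) has_derivative (\<lambda>h. h *\<^sub>R ?d)) (at 0)"
    by (auto intro!: derivative_eq_intros)
  from has_derivative_compose[OF this, of "\<lambda>p'. payoff f p' p" F]
  have "((\<lambda>r. payoff f (p + r *\<^sub>R ?d) p) has_derivative (\<lambda>h. F (h *\<^sub>R ?d))) (at 0)"
    using F by simp
  then have "((\<lambda>r. payoff f p p) has_derivative (\<lambda>h. F (h *\<^sub>R ?d))) (at 0)"
    using eventually_payoff_tangent_shift[OF assms]
    by (rule has_derivative_transform_eventually) auto
  then have "(\<lambda>h. F (h *\<^sub>R ?d)) = (\<lambda>h. 0)"
    by (rule has_derivative_unique) (rule has_derivative_const)
  from fun_cong[OF this, of 1] have "F ?d = 0"
    by simp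
  also have "?d = (\<Sum>i\<in>UNIV. ?d $ i *\<^sub>R axis i 1)"
    by (simp add: basis_expansion flip: scalar_mult_eq_scaleR)
  also have "F \<dots> = (\<Sum>i\<in>UNIV. ?d $ i * F (axis i 1))"
    using has_derivative_bounded_linear[OF F]
    by (simp add: linear_sum[OF bounded_linear.linear] linear_simps)
  finally show ?thesis
    by (simp add: inner_vec_def adaptive_field_nth[OF F] mult.commute)
qed

lemma adaptive_field_orthogonal:
  assumes "p \<in> payoff_domain"
  shows "(p$1 - 1) * adaptive_field f p $ 1 + p$3 * adaptive_field f p $ 3 = 0"
    and "(p$2 - 1) * adaptive_field f p $ 2 + p$4 * adaptive_field f p $ 4 = 0"
  using adaptive_field_tangent_shift[OF assms, of f 1 0]
    adaptive_field_tangent_shift[OF assms, of f 0 1]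
  by (simp_all add: tangent_shift_def inner_vec_def sum_4 mult.commute)

section \<open>Conserved quantities along solutions\<close>

lemma adaptive_solution_first_integral:
  assumes x: "adaptive_solution f I x" and I: "s \<in> I" "t \<in> I"
    and orth: "\<And>p. p \<in> payoff_domain \<Longrightarrow>
      (p $ i - 1) * adaptive_field f p $ i + p $ j * adaptive_field f p $ j = 0"
  shows "(x t $ i - 1)\<^sup>2 + (x t $ j)\<^sup>2 = (x s $ i - 1)\<^sup>2 + (x s $ j)\<^sup>2"
proof -
  let ?\<phi> = "\<lambda>t. (x t $ i - 1)\<^sup>2 + (x t $ j)\<^sup>2"
  have deriv: "(?\<phi> has_real_derivative 0) (at u within I)" if "u \<in> I" for u
  proof -
    have u: "x u \<in> payoff_domain"
      "(x has_vector_derivative adaptive_field f (x u)) (at u within I)"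
      using x that by (auto simp: adaptive_solution_def)
    have "((\<lambda>t. x t $ k) has_real_derivative adaptive_field f (x u) $ k) (at u within I)" for k
      using bounded_linear.has_vector_derivative[OF bounded_linear_vec_nth u(2)]
      by (simp add: has_real_derivative_iff_has_vector_derivative)
    then have "(?\<phi> has_real_derivative 2 * ((x u $ i - 1) * adaptive_field f (x u) $ i
        + x u $ j * adaptive_field f (x u) $ j)) (at u within I)"
      by (auto intro!: derivative_eq_intros simp: algebra_simps)
    then show ?thesis
      by (simp add: orth[OF u(1)])
  qed
  \<comment> \<open>Connectedness of the time domain is what turns the zero derivative into
    constancy.\<close>
  have "convex I"
    using x by (simp add: adaptive_solution_def is_interval_convex)
  from has_field_derivative_zero_constant[OF this deriv] show ?thesis
    using I by auto
qed

lemma adaptive_solution_invariant_torus: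
  assumes "adaptive_solution f I x" "s \<in> I" "t \<in> I" and s: "x s \<in> invariant_torus C1 C2"
  shows "x t \<in> invariant_torus C1 C2"
proof -
  have "(x t $ 1 - 1)\<^sup>2 + (x t $ 3)\<^sup>2 = (x s $ 1 - 1)\<^sup>2 + (x s $ 3)\<^sup>2"
    using assms(1-3) adaptive_field_orthogonal(1)
    by (rule adaptive_solution_first_integral)
  moreover have "(x t $ 2 - 1)\<^sup>2 + (x t $ 4)\<^sup>2 = (x s $ 2 - 1)\<^sup>2 + (x s $ 4)\<^sup>2"
    using assms(1-3) adaptive_field_orthogonal(2)
    by (rule adaptive_solution_first_integral)
  ultimately show ?thesis
    using s by (simp add: invariant_torus_def)
qed

section \<open>Topology of the torus\<close>

lemma continuous_on_vec_componentwise: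
  fixes f :: "'a::topological_space \<Rightarrow> 'b::topological_space ^ 'n"
  assumes "\<And>i. continuous_on S (\<lambda>x. f x $ i)"
  shows "continuous_on S f"
  using continuous_on_vec_lambda[of S "\<lambda>i x. f x $ i"] assms by simp

lemma unit_circle_eq: "sphere (0 :: real ^ 2) 1 = {u. (u$1)\<^sup>2 + (u$2)\<^sup>2 = 1}"
  by (auto simp add: norm_eq_1 inner_vec_def sum_2 power2_eq_square)

text \<open>Each circle is centred at the origin and rescaled to radius 1; coordinates 1 and 3 give
  the first circle, 2 and 4 the second.\<close>

lemma invariant_torus_homeomorphic:
  assumes "C1 > 0" "C2 > 0"
  shows "invariant_torus C1 C2 homeomorphic sphere (0 :: real ^ 2) 1 \<times> sphere (0 :: real ^ 2) 1"
proof -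
  define r s where "r = sqrt C1" and "s = sqrt C2"
  have r: "r > 0" "C1 = r\<^sup>2" and s: "s > 0" "C2 = s\<^sup>2"
    using assms by (auto simp: r_def s_def)
  define f :: "real ^ 4 \<Rightarrow> (real ^ 2) \<times> (real ^ 2)"
    where "f p = (vector [(p$1 - 1) / r, p$3 / r], vector [(p$2 - 1) / s, p$4 / s])" for p
  define g :: "(real ^ 2) \<times> (real ^ 2) \<Rightarrow> real ^ 4"
    where "g z = vector [1 + r * fst z $ 1, 1 + s * snd z $ 1, r * fst z $ 2, s * snd z $ 2]" for z
  have "homeomorphism (invariant_torus C1 C2) (sphere 0 1 \<times> sphere 0 1) f g"
  proof (rule homeomorphismI)
    have "continuous_on A (\<lambda>p. (vector [(p$1 - 1) / r, p$3 / r] :: real ^ 2) $ i)"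
      "continuous_on A (\<lambda>p. (vector [(p$2 - 1) / s, p$4 / s] :: real ^ 2) $ i)"
      for A :: "(real ^ 4) set" and i
      using exhaust_2[of i] r s by (elim disjE; simp; intro continuous_intros; simp)+
    then have "continuous_on A (\<lambda>p. vector [(p$1 - 1) / r, p$3 / r] :: real ^ 2)"
      "continuous_on A (\<lambda>p. vector [(p$2 - 1) / s, p$4 / s] :: real ^ 2)" for A :: "(real ^ 4) set"
      by (blast intro: continuous_on_vec_componentwise)+
    then show "continuous_on (invariant_torus C1 C2) f"
      unfolding f_def by (rule continuous_on_Pair)
    show "continuous_on (sphere 0 1 \<times> sphere 0 1) g"
    proof (rule continuous_on_vec_componentwise)
      show "continuous_on (sphere 0 1 \<times> sphere 0 1) (\<lambda>z. g z $ i)" for i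
        using exhaust_4[of i] unfolding g_def
        by (elim disjE; simp; intro continuous_intros)
    qed
    show "f ` invariant_torus C1 C2 \<subseteq> sphere 0 1 \<times> sphere 0 1"
      using r s unfolding unit_circle_eq
      by (auto simp: f_def invariant_torus_def power_divide simp flip: add_divide_distrib)
    show "g ` (sphere 0 1 \<times> sphere 0 1) \<subseteq> invariant_torus C1 C2"
      using r s unfolding unit_circle_eq
      by (auto simp: g_def invariant_torus_def power_mult_distrib simp flip: distrib_left)
    \<comment> \<open>As \<open>r\<close> and \<open>s\<close> are nonzero, the affine maps
      \<open>f\<close> and \<open>g\<close> are mutually inverse on the whole spaces.\<close>
    show "g (f p) = p" for p
      using r s by (simp add: f_def g_def vec_eq_iff forall_4)
    show "f (g z) = z" for z
      using r s by (simp add: f_def g_def vec_eq_iff forall_2 prod_eq_iff)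
  qed
  then show ?thesis
    unfolding homeomorphic_def by blast
qed

theorem corollary3p5:
  fixes B C C1 C2 :: real
  assumes "0 < C" and "C < B" and "B < 1"
    and "C1 > 0" and "C2 > 0"
  shows "invariant_torus C1 C2 homeomorphic (sphere (0 :: real ^ 2) 1 \<times> sphere (0 :: real ^ 2) 1)
    \<and> (\<forall>I x t0. adaptive_solution (vector [B - C, - C, B, 0]) I x \<longrightarrow> t0 \<in> I \<longrightarrow>
          x t0 \<in> invariant_torus C1 C2 \<longrightarrow> (\<forall>t\<in>I. x t \<in> invariant_torus C1 C2))"
  using invariant_torus_homeomorphic[OF assms(4,5)] adaptive_solution_invariant_torus by blast

end
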